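(* Let $d,s\ge 1$ be integers, let $S:\mathbb{R}^d\to\mathbb{R}^{d\times d}$ be a skew-symmetric matrix function, and let $V(y)=\frac12\langle y,Qy\rangle$ with $Q\in\mathbb{R}^{d\times d}$ symmetric. Suppose that the coefficients $A=(a_{ij})\in\mathbb{R}^{s\times s}$ and $b=(b_i)\in\mathbb{R}^s$ satisfy $$b_i a_{ij}+b_j a_{ji}=b_i b_j\qquad\text{for all } i,j\in\{1,\dots,s\}.$$ Let $y_0\in\mathbb{R}^d$ and let $\widehat Y_1,\dots,\widehat Y_s\in\mathbb{R}^d$ be given vectors. Then, for any $h>0$, the solution $y_1$ of $$Y_i=y_0+h\sum_{j=1}^s a_{ij}\,S(\widehat Y_j)\,\nabla V(Y_j)\quad(i=1,\dots,s),\qquad y_1=y_0+h\sum_{i=1}^s b_i\,S(\widehat Y_i)\,\nabla V(Y_i)$$ (with unknowns $Y_1,\dots,Y_s,y_1\in\mathbb{R}^d$) satisfies $V(y_1)=V(y_0)$.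
   Context: $\langle\cdot,\cdot\rangle$ is the standard inner product on $\mathbb{R}^d$. Skew-symmetric matrix function means $S(y)^{T}=-S(y)$ for all $y\in\mathbb{R}^d$. Since $Q$ is symmetric, $\nabla V(y)=Qy$. The scheme is a discretisation of the ODE $\dot y=S(y)\nabla V(y)$, and the vectors $\widehat Y_i$ play the role of previously prepared approximations of the exact solution at intermediate times. *)

theory Defs
  imports "HOL-Analysis.Analysis"
begin

text \<open>The library has only the relation \<open>GDERIV f x :> D\<close>. The gradient is unique when it exists,
  and unspecified otherwise.\<close>

definition gradient :: "('a::real_inner \<Rightarrow> real) \<Rightarrow> 'a \<Rightarrow> 'a" where
  "gradient f x = (THE D. GDERIV f x :> D)"

definition symmetric_matrix :: "real ^ 'n ^ 'n \<Rightarrow> bool" where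
  "symmetric_matrix M \<longleftrightarrow> transpose M = M"

definition skew_symmetric_matrix_function :: "(real ^ 'n \<Rightarrow> real ^ 'n ^ 'n) \<Rightarrow> bool" where
  "skew_symmetric_matrix_function S \<longleftrightarrow> (\<forall>y. transpose (S y) = - S y)"

end

theory Submission
  imports Defs
begin

text \<open>Put \<open>k\<^sub>i = S(Yhat\<^sub>i) Q Y\<^sub>i\<close> and \<open>q(x,y) = x \<bullet> Qy\<close>. Skewness gives \<open>q(k\<^sub>i, Y\<^sub>i) = 0\<close>. Hence, inserting
  \<open>y\<^sub>0 = Y\<^sub>i - h \<Sum>\<^sub>j a\<^sub>i\<^sub>j k\<^sub>j\<close> into the cross terms of the expansion of \<open>q(y\<^sub>1, y\<^sub>1)\<close>, one finds
  \<open>q(y\<^sub>1, y\<^sub>1) - q(y\<^sub>0, y\<^sub>0) = h\<^sup>2 \<Sum>\<^sub>i\<^sub>j (b\<^sub>i b\<^sub>j - 2 b\<^sub>i a\<^sub>i\<^sub>j) q(k\<^sub>i, k\<^sub>j)\<close>. Since \<open>q\<close> is symmetric, only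
  the symmetric part \<open>b\<^sub>i b\<^sub>j - b\<^sub>i a\<^sub>i\<^sub>j - b\<^sub>j a\<^sub>j\<^sub>i = 0\<close> of the coefficients matters.\<close>

text \<open>Frechet derivatives are unique, and a vector is determined by its inner products with
  all vectors.\<close>

lemma gradient_eqI:
  assumes "GDERIV f x :> D"
  shows "gradient f x = D"
  unfolding gradient_def
proof (rule the_equality)
  show "GDERIV f x :> D" by (rule assms)
next
  fix D' assume "GDERIV f x :> D'"
  with assms have "(\<lambda>u. u \<bullet> D') = (\<lambda>u. u \<bullet> D)"
    unfolding gderiv_def by (rule has_derivative_unique[rotated])
  then show "D' = D"
    by (metis inner_commute vector_eq_rdot)
qed

lemma symmetric_matrix_inner:
  assumes "symmetric_matrix Q"
  shows "x \<bullet> (Q *v y) = y \<bullet> (Q *v x)"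
proof -
  have "x \<bullet> (Q *v y) = (transpose Q *v x) \<bullet> y"
    by (simp add: dot_lmul_matrix)
  then show ?thesis
    using assms unfolding symmetric_matrix_def by (metis inner_commute)
qed

text \<open>The product rule yields two terms; symmetry of \<open>Q\<close> makes them equal, and
  the factor 1/2 absorbs the resulting 2.\<close>

lemma gradient_quadratic_form:
  assumes "symmetric_matrix Q"
  shows "gradient (\<lambda>y. 1 / 2 * (y \<bullet> (Q *v y))) x = Q *v x"
proof (rule gradient_eqI)
  have "((*v) Q has_derivative (*v) Q) (at x)"
    by (rule bounded_linear_imp_has_derivative) (rule matrix_vector_mul_bounded_linear)
  moreover have sym: "x \<bullet> (Q *v u) + u \<bullet> (Q *v x) = 2 * (u \<bullet> (Q *v x))" for u
    using symmetric_matrix_inner[OF assms, of x u] by simp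
  ultimately show "GDERIV (\<lambda>y. 1 / 2 * (y \<bullet> (Q *v y))) x :> Q *v x"
    unfolding gderiv_def
    by (auto intro!: derivative_eq_intros simp: fun_eq_iff sym)
qed

text \<open>Moving \<open>M\<close> across the inner product turns it into \<open>- M\<close>, so
  the value equals its own negative.\<close>

lemma skew_symmetric_matrix_inner:
  fixes M :: "real ^ 'n ^ 'n"
  assumes "transpose M = - M"
  shows "(M *v x) \<bullet> x = 0"
proof -
  have "(M *v x) \<bullet> x = x \<bullet> (transpose M *v x)"
    by (metis dot_lmul_matrix transpose_matrix_vector transpose_transpose)
  also have "\<dots> = - ((M *v x) \<bullet> x)"
    by (simp add: assms inner_commute matrix_vector_mult_def inner_vec_def sum_negf)
  finally show ?thesis by simp
qed

lemma sum_symmetrized_eq_0: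
  fixes c G :: "'i \<Rightarrow> 'i \<Rightarrow> real"
  assumes "\<And>i j. c i j + c j i = 0" and "\<And>i j. G i j = G j i"
  shows "(\<Sum>i\<in>I. \<Sum>j\<in>I. c i j * G i j) = 0"
proof -
  have "(\<Sum>i\<in>I. \<Sum>j\<in>I. c i j * G i j) = (\<Sum>i\<in>I. \<Sum>j\<in>I. c j i * G j i)"
    by (rule sum.swap)
  also have "\<dots> = (\<Sum>i\<in>I. \<Sum>j\<in>I. - (c i j * G i j))"
    by (intro sum.cong refl) (metis add_eq_0_iff assms mult_minus_left)
  finally show ?thesis by (simp add: sum_negf)
qed

text \<open>The algebraic core, for arbitrary slopes \<open>k\<close>: the differential equation
  enters only through \<open>orth\<close>.\<close>

lemma bilinear_runge_kutta_invariant: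
  fixes q :: "'v::real_vector \<Rightarrow> 'v \<Rightarrow> real" and a :: "'i \<Rightarrow> 'i \<Rightarrow> real"
  assumes q: "bilinear q" and sym: "\<And>x y. q x y = q y x"
    and orth: "\<And>i. q (k i) (Y i) = 0"
    and coeff: "\<And>i j. b i * a i j + b j * a j i = b i * b j"
    and Y: "\<And>i. Y i = y0 + h *\<^sub>R (\<Sum>j\<in>I. a i j *\<^sub>R k j)"
  defines "u \<equiv> \<Sum>i\<in>I. b i *\<^sub>R k i"
  shows "q (y0 + h *\<^sub>R u) (y0 + h *\<^sub>R u) = q y0 y0"
proof -
  have lin: "linear (q x)" "linear (\<lambda>x. q x y)" for x y
    using q by (auto simp: bilinear_def)
  note expand = bilinear_ladd[OF q] bilinear_radd[OF q] bilinear_lmul[OF q] bilinear_rmul[OF q]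
    linear_sum[OF lin(1)] linear_sum[OF lin(2)]
  \<comment> \<open>Expand \<open>Y i\<close> in \<open>orth\<close> and solve for the term with
    \<open>y0\<close>.\<close>
  have cross: "q (k i) y0 = - h * (\<Sum>j\<in>I. a i j * q (k i) (k j))" for i
    using orth[of i] by (simp add: Y expand)
  have "q u y0 = - h * (\<Sum>i\<in>I. \<Sum>j\<in>I. b i * a i j * q (k i) (k j))"
    by (simp add: u_def expand cross sum_distrib_left mult_ac sum_negf)
  moreover have "q u u = (\<Sum>i\<in>I. \<Sum>j\<in>I. b i * b j * q (k i) (k j))"
    \<comment> \<open>Expanding the left argument first makes its index the outer one.\<close>
    by (simp add: u_def linear_sum[OF lin(2)] bilinear_lmul[OF q])
       (simp add: expand sum_distrib_left mult_ac)
  moreover have "q (y0 + h *\<^sub>R u) (y0 + h *\<^sub>R u) - q y0 y0 = 2 * h * q u y0 + h\<^sup>2 * q u u"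
    by (simp add: bilinear_ladd[OF q] bilinear_radd[OF q] bilinear_lmul[OF q] bilinear_rmul[OF q]
        sym[of y0 u] power2_eq_square algebra_simps)
  ultimately have "q (y0 + h *\<^sub>R u) (y0 + h *\<^sub>R u) - q y0 y0 =
      h\<^sup>2 * (\<Sum>i\<in>I. \<Sum>j\<in>I. (b i * b j - 2 * (b i * a i j)) * q (k i) (k j))"
    by (simp add: left_diff_distrib right_diff_distrib sum_subtractf sum_distrib_left
        power2_eq_square mult_ac sum_negf)
  \<comment> \<open>Adding the coefficients at (i,j) and (j,i) gives twice the defect in
    \<open>coeff\<close>, which is 0.\<close>
  also have "(\<Sum>i\<in>I. \<Sum>j\<in>I. (b i * b j - 2 * (b i * a i j)) * q (k i) (k j)) = 0"
    using coeff by (intro sum_symmetrized_eq_0 sym) (smt (verit) mult.commute)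
  finally show ?thesis by simp
qed

lemma bilinear_matrix_inner: "bilinear (\<lambda>x y. x \<bullet> ((Q :: real ^ 'n ^ 'n) *v y))"
  unfolding bilinear_def
  by (intro conjI allI linearI) (simp_all add: inner_add_left inner_add_right matrix_vector_right_distrib matrix_vector_mult_scaleR)

theorem theorem3p1:
  fixes S :: "real ^ 'd \<Rightarrow> real ^ 'd ^ 'd"
    and Q :: "real ^ 'd ^ 'd"
    and V :: "real ^ 'd \<Rightarrow> real"
    and A :: "real ^ 's ^ 's"
    and b :: "real ^ 's"
    and Yhat Y :: "'s \<Rightarrow> real ^ 'd"
    and y0 y1 :: "real ^ 'd"
    and h :: real
  assumes "skew_symmetric_matrix_function S"
    and "symmetric_matrix Q"
    and "\<And>y. V y = 1 / 2 * (y \<bullet> (Q *v y))"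
    and "\<And>i j. b $ i * A $ i $ j + b $ j * A $ j $ i = b $ i * b $ j"
    and "h > 0"
    and "\<And>i. Y i = y0 + h *\<^sub>R (\<Sum>j\<in>UNIV. A $ i $ j *\<^sub>R (S (Yhat j) *v gradient V (Y j)))"
    and "y1 = y0 + h *\<^sub>R (\<Sum>i\<in>UNIV. b $ i *\<^sub>R (S (Yhat i) *v gradient V (Y i)))"
  shows "V y1 = V y0"
proof -
  have V: "V = (\<lambda>y. 1 / 2 * (y \<bullet> (Q *v y)))"
    using assms(3) by blast
  have grad: "gradient V y = Q *v y" for y
    unfolding V using assms(2) by (rule gradient_quadratic_form)
  have "y1 \<bullet> (Q *v y1) = y0 \<bullet> (Q *v y0)"
    unfolding assms(7)
  proof (rule bilinear_runge_kutta_invariant[where q = "\<lambda>x y. x \<bullet> (Q *v y)" and a = "\<lambda>i j. A $ i $ j" and Y = Y])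
    show "bilinear (\<lambda>x y. x \<bullet> (Q *v y))"
      by (rule bilinear_matrix_inner)
    show "x \<bullet> (Q *v y) = y \<bullet> (Q *v x)" for x y
      using assms(2) by (rule symmetric_matrix_inner)
    \<comment> \<open>Both factors involve the same vector \<open>Q *v Y i\<close>, and
      \<open>S\<close> is skew at every point, so evaluating it at \<open>Yhat i\<close> instead of
      \<open>Y i\<close> does no harm.\<close>
    show "(S (Yhat i) *v gradient V (Y i)) \<bullet> (Q *v Y i) = 0" for i
      using assms(1) by (simp add: grad skew_symmetric_matrix_function_def skew_symmetric_matrix_inner)
    show "b $ i * A $ i $ j + b $ j * A $ j $ i = b $ i * b $ j" for i j
      by (rule assms(4))
    show "Y i = y0 + h *\<^sub>R (\<Sum>j\<in>UNIV. A $ i $ j *\<^sub>R (S (Yhat j) *v gradient V (Y j)))" for i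
      by (rule assms(6))
  qed
  then show ?thesis by (simp add: V)
qed

end
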